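(* Let $n\ge 3$ be an integer and let $0<x_1\le x_2\le\dots\le x_n$ be positive integers with $\sigma_{n-2}(x_1,\dots,x_n)=\sigma_n(x_1,\dots,x_n)$. Then $x_n\le v_n-1$.
   Context: For $1\le j\le n$, $\sigma_j(x_1,\dots,x_n)=\sum_{1\le i_1<\dots<i_j\le n}x_{i_1}\cdots x_{i_j}$ is the $j$th elementary symmetric polynomial. The sequence $(v_n)_{n\ge1}$ is defined recursively by $v_1=1$, $v_2=2$, and for $n\ge 2$ $$v_{n+1}=1+\frac{\sum_{1\le i\le n}\frac{1}{v_i}}{1-\sum_{1\le i<j\le n}\frac{1}{v_iv_j}}.$$ Its first terms are $1,2,4,15,219,47863,\dots$; it is an increasing sequence of positive integers. *)

theory Defs
  imports Complex_Main
begin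

definition esym :: "nat \<Rightarrow> nat \<Rightarrow> (nat \<Rightarrow> 'a::comm_semiring_1) \<Rightarrow> 'a" where
  "esym n j x = (\<Sum>I | I \<subseteq> {1..n} \<and> card I = j. \<Prod>i\<in>I. x i)"

(* The sequence is indexed from 1; the value at 0 is a dummy and is never used. *)
function vseq :: "nat \<Rightarrow> real" where
  "vseq 0 = 0"
| "vseq (Suc 0) = 1"
| "vseq (Suc (Suc 0)) = 2"
| "vseq (Suc (Suc (Suc m))) =
     1 + (\<Sum>i = 1..m + 2. 1 / vseq i) /
         (1 - (\<Sum>j = 1..m + 2. \<Sum>i = 1..<j. 1 / (vseq i * vseq j)))"
  by pat_completeness auto
termination
  by (relation "measure id") auto

lemma vseq_1: "vseq 1 = 1" and vseq_2: "vseq 2 = 2"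
  by (simp_all add: numeral_2_eq_2)

lemma vseq_rec:
  assumes "n \<ge> 2"
  shows "vseq (n + 1) =
    1 + (\<Sum>i = 1..n. 1 / vseq i) / (1 - (\<Sum>j = 1..n. \<Sum>i = 1..<j. 1 / (vseq i * vseq j)))"
proof -
  from assms obtain m where "n = m + 2"
    by (metis add.commute le_Suc_ex)
  then show ?thesis
    using vseq.simps(4)[of m] by (simp del: vseq.simps)
qed

lemma vseq_first_terms: "vseq 3 = 4" "vseq 4 = 15" "vseq 5 = 219" "vseq 6 = 47863"
proof -
  have *: "{Suc 0..2::nat} = {1, 2}" "{Suc 0..3::nat} = {1, 2, 3}" "{Suc 0..4::nat} = {1, 2, 3, 4}"
    "{Suc 0..5::nat} = {1, 2, 3, 4, 5}" "{Suc 0..<2::nat} = {1}"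
    "{Suc 0..<3::nat} = {1, 2}" "{Suc 0..<4::nat} = {1, 2, 3}" "{Suc 0..<5::nat} = {1, 2, 3, 4}"
    by auto
  show v3: "vseq 3 = 4"
    using vseq_rec[of 2] by (simp add: * vseq_1[simplified] vseq_2)
  show v4: "vseq 4 = 15"
    using vseq_rec[of 3] by (simp add: * vseq_1[simplified] vseq_2 v3)
  show v5: "vseq 5 = 219"
    using vseq_rec[of 4] by (simp add: * vseq_1[simplified] vseq_2 v3 v4)
  show "vseq 6 = 47863"
    using vseq_rec[of 5] by (simp add: * vseq_1[simplified] vseq_2 v3 v4 v5)
qed

end

theory Submission
  imports Defs
begin

text \<open>
  Write \<open>e\<^sub>j\<close> for \<open>esym m j\<close>, \<open>y = 1/x\<close>, \<open>w = 1/v\<close>. The equation says \<open>e\<^sub>2(y\<^sub>1,\<dots>,y\<^sub>n) = 1\<close>, so with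
  \<open>m = n - 1\<close> it suffices to show \<open>e\<^sub>2(y) + r e\<^sub>1(y) \<le> e\<^sub>2(w) + r e\<^sub>1(w)\<close> for \<open>r = 1/(v\<^bsub>m+1\<^esub> - 1)\<close>, where
  the right-hand side is \<open>1\<close>. This is proved for all \<open>0 \<le> r \<le> 1/(v\<^bsub>m+1\<^esub> - 1)\<close> by strong induction on
  \<open>m\<close>. Let \<open>k \<le> m\<close> minimize the ratio of the prefix products \<open>x\<^sub>1\<cdots>x\<^sub>k / v\<^sub>1\<cdots>v\<^sub>k\<close>.

  If \<open>k < m\<close>, then \<open>y\<close> is weakly log-majorized by \<open>w\<close> beyond position \<open>k\<close>, which bounds \<open>e\<^sub>1\<close> and
  \<open>e\<^sub>2\<close> of the tail; the first \<open>k\<close> terms are handled by induction, with \<open>r\<close> increased by \<open>e\<^sub>1\<close> of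
  the tail of \<open>w\<close>. If \<open>k = m\<close>, then \<open>P = x\<^sub>1\<cdots>x\<^sub>m \<le> Q = v\<^sub>1\<cdots>v\<^sub>m\<close>, integrality gives
  \<open>1 - e\<^sub>2(y) \<ge> 1/P\<close>, while \<open>1 - e\<^sub>2(w) = 1/Q\<close>, and \<open>P e\<^sub>1(y) \<le> Q e\<^sub>1(w) = v\<^bsub>m+1\<^esub> - 1\<close> since the
  numbers \<open>P/x\<^sub>i\<close> are weakly log-majorized by the numbers \<open>Q/v\<^sub>i\<close>.
\<close>

section \<open>Elementary symmetric polynomials: recursion, reciprocals, splitting of the
  variables\<close>

lemma esym_0 [simp]: "esym n 0 x = 1"
proof -
  have "{I. I \<subseteq> {1..n} \<and> card I = 0} = {{}}"
    by (auto dest: finite_subset[OF _ finite_atLeastAtMost])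
  then show ?thesis by (simp add: esym_def)
qed

lemma esym_0_Suc [simp]: "esym 0 (Suc j) x = 0"
proof -
  have "{I. I \<subseteq> {1..0::nat} \<and> card I = Suc j} = {}" by auto
  then show ?thesis unfolding esym_def by (metis sum.empty)
qed

lemma esym_Suc_Suc: "esym (Suc n) (Suc j) x = esym n (Suc j) x + x (Suc n) * esym n j x"
proof -
  let ?A = "{I. I \<subseteq> {1..n} \<and> card I = Suc j}" and ?B = "{I. I \<subseteq> {1..n} \<and> card I = j}"
  have fin: "finite I" if "I \<subseteq> {1..n}" for I
    using that finite_subset by blast
  have not_in: "Suc n \<notin> I" if "I \<subseteq> {1..n}" for I
    using that by auto
  have inj: "inj_on (insert (Suc n)) ?B"
    using not_in by (intro inj_onI) (metis (no_types, lifting) insert_ident mem_Collect_eq)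
  have "I \<in> ?A \<union> insert (Suc n) ` ?B" if I: "I \<subseteq> {1..Suc n}" "card I = Suc j" for I
  proof (cases "Suc n \<in> I")
    case True
    then have "I - {Suc n} \<in> ?B" "I = insert (Suc n) (I - {Suc n})"
      using I by (auto simp: atLeastAtMostSuc_conv)
    then show ?thesis by blast
  next
    case False
    then show ?thesis using I by (auto simp: atLeastAtMostSuc_conv)
  qed
  moreover have "?A \<union> insert (Suc n) ` ?B \<subseteq> {I. I \<subseteq> {1..Suc n} \<and> card I = Suc j}"
    using fin not_in by fastforce
  ultimately have "{I. I \<subseteq> {1..Suc n} \<and> card I = Suc j} = ?A \<union> insert (Suc n) ` ?B"
    by blast
  moreover have "?A \<inter> insert (Suc n) ` ?B = {}"
    using not_in by blast
  ultimately have "esym (Suc n) (Suc j) x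
      = esym n (Suc j) x + (\<Sum>I\<in>insert (Suc n) ` ?B. \<Prod>i\<in>I. x i)"
    unfolding esym_def by (simp add: sum.union_disjoint)
  also have "(\<Sum>I\<in>insert (Suc n) ` ?B. \<Prod>i\<in>I. x i) = (\<Sum>I\<in>?B. x (Suc n) * (\<Prod>i\<in>I. x i))"
    using fin not_in by (subst sum.reindex[OF inj]) (auto intro!: sum.cong)
  finally show ?thesis
    by (simp add: esym_def sum_distrib_left)
qed

lemma esym_1: "esym n (Suc 0) x = (\<Sum>i = 1..n. x i)"
  by (induction n) (simp_all add: esym_Suc_Suc)

lemma esym_2: "esym n 2 x = (\<Sum>j = 1..n. \<Sum>i = 1..<j. x i * x j)"
  unfolding numeral_2_eq_2
proof (induction n)
  case (Suc n)
  have "{Suc 0..<Suc n} = {1..n}" by auto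
  with Suc show ?case
    by (simp add: esym_Suc_Suc esym_1 sum_distrib_left mult.commute)
qed simp

lemma esym_self: "esym n n x = (\<Prod>i = 1..n. x i)"
proof -
  have "{I. I \<subseteq> {1..n} \<and> card I = n} = {{1..n}}"
    by (auto dest!: card_subset_eq[OF finite_atLeastAtMost])
  then show ?thesis by (simp add: esym_def)
qed

lemma esym_eq_0: "n < j \<Longrightarrow> esym n j x = 0"
proof (induction n arbitrary: j)
  case 0
  then show ?case by (cases j) auto
next
  case (Suc n)
  then show ?case by (cases j) (auto simp: esym_Suc_Suc)
qed

lemma esym_of_nat: "esym n j (\<lambda>i. of_nat (x i)) = of_nat (esym n j x)"
  by (simp add: esym_def)

lemma esym_nonneg:
  fixes x :: "nat \<Rightarrow> real"
  assumes "\<And>i. i \<in> {1..n} \<Longrightarrow> 0 \<le> x i"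
  shows "0 \<le> esym n j x"
  unfolding esym_def using assms by (intro sum_nonneg prod_nonneg) auto

text \<open>Complementing the index sets. This turns the given equation into
  \<open>e\<^sub>2 = 1\<close> for the reciprocals and makes \<open>e\<^sub>2\<close> times the full
  product an integer.\<close>

lemma esym_reciprocal:
  fixes x :: "nat \<Rightarrow> real"
  assumes "j \<le> n" and "\<And>i. i \<in> {1..n} \<Longrightarrow> x i \<noteq> 0"
  shows "esym n (n - j) x = (\<Prod>i = 1..n. x i) * esym n j (\<lambda>i. 1 / x i)"
proof -
  have fin: "finite I" if "I \<subseteq> {1..n}" for I
    using that finite_subset by blast
  have *: "(\<Prod>i\<in>{1..n} - I. x i) = (\<Prod>i = 1..n. x i) * (\<Prod>i\<in>I. 1 / x i)"
    if "I \<subseteq> {1..n}" for I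
  proof -
    have "(\<Prod>i = 1..n. x i) = (\<Prod>i\<in>{1..n} - I. x i) * (\<Prod>i\<in>I. x i)"
      using that by (simp add: prod.subset_diff)
    moreover have "(\<Prod>i\<in>I. x i) \<noteq> 0"
      using that assms(2) fin by (auto simp: subset_iff)
    ultimately show ?thesis by (simp add: prod_dividef)
  qed
  show ?thesis
    unfolding esym_def sum_distrib_left
  proof (rule sum.reindex_bij_witness[where i = "\<lambda>I. {1..n} - I" and j = "\<lambda>I. {1..n} - I"])
    fix I assume I: "I \<in> {I. I \<subseteq> {1..n} \<and> card I = n - j}"
    then show "{1..n} - ({1..n} - I) = I"
      and "{1..n} - I \<in> {I. I \<subseteq> {1..n} \<and> card I = j}"
      using assms(1) fin[of I] by (auto simp: card_Diff_subset)
    show "(\<Prod>i = 1..n. x i) * (\<Prod>i\<in>{1..n} - I. 1 / x i) = (\<Prod>i\<in>I. x i)"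
      using *[of "{1..n} - I"] I by (simp add: double_diff)
  next
    fix I assume I: "I \<in> {I. I \<subseteq> {1..n} \<and> card I = j}"
    then show "{1..n} - ({1..n} - I) = I"
      and "{1..n} - I \<in> {I. I \<subseteq> {1..n} \<and> card I = n - j}"
      using fin[of I] by (auto simp: card_Diff_subset)
  qed
qed

lemma esym_1_add: "esym (k + l) (Suc 0) x = esym k (Suc 0) x + esym l (Suc 0) (\<lambda>i. x (k + i))"
  by (induction l) (simp_all add: esym_Suc_Suc add.assoc)

lemma esym_2_add:
  "esym (k + l) 2 x = esym k 2 x + esym k (Suc 0) x * esym l (Suc 0) (\<lambda>i. x (k + i))
     + esym l 2 (\<lambda>i. x (k + i))"
  unfolding numeral_2_eq_2
proof (induction l)
  case (Suc l)
  then show ?case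
    unfolding add_Suc_right esym_Suc_Suc esym_1_add by (simp add: algebra_simps)
qed simp

lemma prod_1_add:
  fixes x :: "nat \<Rightarrow> 'a::comm_monoid_mult"
  shows "(\<Prod>i = 1..k + l. x i) = (\<Prod>i = 1..k. x i) * (\<Prod>i = 1..l. x (k + i))"
  by (induction l) (simp_all add: mult.assoc)

section \<open>Abel summation and log-majorization\<close>

text \<open>Summation by parts: while \<open>c\<close> decreases, \<open>c k\<close> times the
  \<open>k\<close>th partial sum of \<open>d\<close> stays below the \<open>k\<close>th weighted
  sum.\<close>

lemma abel_sum_nonneg:
  fixes c d :: "nat \<Rightarrow> real"
  assumes "\<And>i. 1 \<le> i \<Longrightarrow> i < n \<Longrightarrow> c (Suc i) \<le> c i"
    and "n \<ge> 1 \<Longrightarrow> 0 \<le> c n"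
    and "\<And>k. k \<le> n \<Longrightarrow> 0 \<le> (\<Sum>i = 1..k. d i)"
  shows "0 \<le> (\<Sum>i = 1..n. c i * d i)"
proof -
  have "c k * (\<Sum>i = 1..k. d i) \<le> (\<Sum>i = 1..k. c i * d i)" if "k \<le> n" for k
    using that
  proof (induction k)
    case (Suc k)
    have "c (Suc k) * (\<Sum>i = 1..k. d i) \<le> c k * (\<Sum>i = 1..k. d i)"
    proof (cases "k = 0")
      case False
      with Suc.prems assms(1)[of k] assms(3)[of k] show ?thesis
        by (intro mult_right_mono) auto
    qed simp
    with Suc show ?case by (simp add: algebra_simps)
  qed simp
  from this[of n] have "c n * (\<Sum>i = 1..n. d i) \<le> (\<Sum>i = 1..n. c i * d i)" by simp
  moreover have "0 \<le> c n * (\<Sum>i = 1..n. d i)"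
    using assms(2) assms(3)[of n] by (cases "n = 0") auto
  ultimately show ?thesis by linarith
qed

text \<open>
  Weak log-majorization: in the variables \<open>ln (b i)\<close> the function \<open>esym\<close> is convex, and its
  gradient is nonnegative and ordered like \<open>b\<close>.
\<close>
lemma esym_mono_log_majorization:
  fixes a b :: "nat \<Rightarrow> real"
  assumes a: "\<And>i. i \<in> {1..n} \<Longrightarrow> 0 < a i" and b: "\<And>i. i \<in> {1..n} \<Longrightarrow> 0 < b i"
    and dec: "\<And>i. 1 \<le> i \<Longrightarrow> i < n \<Longrightarrow> b (Suc i) \<le> b i"
    and maj: "\<And>k. k \<le> n \<Longrightarrow> (\<Prod>i = 1..k. b i) \<le> (\<Prod>i = 1..k. a i)"
  shows "esym n j b \<le> esym n j a"
proof -
  define F where "F = {I. I \<subseteq> {1..n} \<and> card I = j}"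
  define d where "d i = ln (a i / b i)" for i
  \<comment> \<open>\<open>c i\<close> is the partial derivative of \<open>esym n j b\<close> with
    respect to \<open>ln (b i)\<close>.\<close>
  define c where "c i = (\<Sum>I | I \<in> F \<and> i \<in> I. \<Prod>h\<in>I. b h)" for i
  have finF: "finite F" by (simp add: F_def)
  have finI: "finite I" if "I \<in> F" for I
    using that finite_subset[of I "{1..n}"] by (auto simp: F_def)
  have posb: "0 < (\<Prod>h\<in>I. b h)" and posa: "0 < (\<Prod>h\<in>I. a h)" if "I \<in> F" for I
    using that a b by (auto simp: F_def intro!: prod_pos)
  \<comment> \<open>Convexity for a single monomial: \<open>ln t <= t - 1\<close>, with
    \<open>t\<close> the ratio of the two products.\<close>
  have tangent: "(\<Prod>h\<in>I. b h) * (\<Sum>i\<in>I. d i) \<le> (\<Prod>h\<in>I. a h) - (\<Prod>h\<in>I. b h)"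
    if I: "I \<in> F" for I
  proof -
    have "a i / b i \<noteq> 0" if "i \<in> I" for i
      using that I a[of i] b[of i] by (auto simp: F_def)
    then have "(\<Sum>i\<in>I. d i) = ln (\<Prod>i\<in>I. a i / b i)"
      unfolding d_def using finI[OF I] by (intro ln_prod[symmetric])
    also have "\<dots> = ln ((\<Prod>h\<in>I. a h) / (\<Prod>h\<in>I. b h))"
      by (simp add: prod_dividef)
    also have "\<dots> \<le> (\<Prod>h\<in>I. a h) / (\<Prod>h\<in>I. b h) - 1"
      using posa[OF I] posb[OF I] by (intro ln_le_minus_one) simp
    finally show ?thesis
      using posb[OF I] by (simp add: field_simps)
  qed
  have "c (Suc i) \<le> c i" if i: "1 \<le> i" "i < n" for i
  proof -
    \<comment> \<open>Transposing \<open>i\<close> and \<open>Suc i\<close> carries the monomials of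
      \<open>c (Suc i)\<close> to those of \<open>c i\<close>. A monomial with both indices is
      fixed; otherwise \<open>b (Suc i)\<close> is replaced by \<open>b i\<close>, which is at least
      as large.\<close>
    define t where "t h = (if h = i then Suc i else if h = Suc i then i else h)" for h
    have tt: "t (t h) = h" for h by (simp add: t_def)
    have inj: "inj_on t I" for I by (metis tt inj_onI)
    have t_F: "t ` I \<in> F" if "I \<in> F" for I
      using that i card_image[OF inj, of I] unfolding F_def
      by (auto simp: t_def subset_iff)
    have "c (Suc i) \<le> (\<Sum>I | I \<in> F \<and> Suc i \<in> I. \<Prod>h\<in>t ` I. b h)"
      unfolding c_def
    proof (rule sum_mono)
      fix I assume "I \<in> {I. I \<in> F \<and> Suc i \<in> I}"
      then have I: "I \<in> F" "Suc i \<in> I" by auto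
      show "(\<Prod>h\<in>I. b h) \<le> (\<Prod>h\<in>t ` I. b h)"
      proof (cases "i \<in> I")
        case True
        then have "t ` I \<subseteq> I" using I by (auto simp: t_def)
        then have "t ` I = I"
          using card_image[OF inj, of I] card_subset_eq finI I by metis
        then show ?thesis by simp
      next
        case False
        have "(\<Prod>h\<in>t ` I. b h) = (\<Prod>h\<in>I. b (t h))"
          by (simp add: prod.reindex[OF inj])
        moreover have "(\<Prod>h\<in>I. b h) \<le> (\<Prod>h\<in>I. b (t h))"
        proof (rule prod_mono)
          fix h assume h: "h \<in> I"
          then have "0 \<le> b h" using I(1) b[of h] by (auto simp: F_def)
          then show "0 \<le> b h \<and> b h \<le> b (t h)"
            using h False dec[OF i] by (auto simp: t_def)
        qed
        ultimately show ?thesis by simp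
      qed
    qed
    also have "\<dots> = c i"
      unfolding c_def
    proof (rule sum.reindex_bij_witness[where i = "(`) t" and j = "(`) t"])
      have t_i: "t i = Suc i" "t (Suc i) = i" by (simp_all add: t_def)
      show "t ` t ` I = I" for I by (simp add: image_image tt)
      show "t ` t ` I = I" for I by (simp add: image_image tt)
      show "t ` I \<in> {I. I \<in> F \<and> i \<in> I}" if "I \<in> {I. I \<in> F \<and> Suc i \<in> I}" for I
        using that t_F imageI[of "Suc i" I t] by (simp add: t_i)
      show "t ` I \<in> {I. I \<in> F \<and> Suc i \<in> I}" if "I \<in> {I. I \<in> F \<and> i \<in> I}" for I
        using that t_F imageI[of i I t] by (simp add: t_i)
    qed simp
    finally show ?thesis .
  qed
  moreover have "0 \<le> c i" for i
    unfolding c_def using posb by (intro sum_nonneg) (auto intro: less_imp_le)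
  moreover have "0 \<le> (\<Sum>i = 1..k. d i)" if "k \<le> n" for k
  proof -
    have pos: "0 < (\<Prod>i = 1..k. b i)" "0 < (\<Prod>i = 1..k. a i)"
      using that a b by (auto intro!: prod_pos)
    have "a i / b i \<noteq> 0" if "i \<in> {1..k}" for i
      using that \<open>k \<le> n\<close> a[of i] b[of i] by auto
    then have "(\<Sum>i = 1..k. d i) = ln (\<Prod>i = 1..k. a i / b i)"
      unfolding d_def by (intro ln_prod[symmetric]) auto
    also have "\<dots> = ln ((\<Prod>i = 1..k. a i) / (\<Prod>i = 1..k. b i))"
      by (simp add: prod_dividef)
    finally show ?thesis
      using maj[OF that] pos by simp
  qed
  ultimately have "0 \<le> (\<Sum>i = 1..n. c i * d i)"
    by (intro abel_sum_nonneg) auto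
  also have "\<dots> = (\<Sum>i = 1..n. \<Sum>I | I \<in> F \<and> i \<in> I. (\<Prod>h\<in>I. b h) * d i)"
    by (simp add: c_def sum_distrib_right)
  \<comment> \<open>Exchanging the sums collects, for each \<open>I\<close>, the left-hand side of
    \<open>tangent\<close>.\<close>
  also have "\<dots> = (\<Sum>I\<in>F. \<Sum>i | i \<in> {1..n} \<and> i \<in> I. (\<Prod>h\<in>I. b h) * d i)"
    using finF by (subst sum.swap_restrict) auto
  also have "\<dots> = (\<Sum>I\<in>F. (\<Prod>h\<in>I. b h) * (\<Sum>i\<in>I. d i))"
    unfolding sum_distrib_left by (intro sum.cong) (auto simp: F_def)
  also have "\<dots> \<le> (\<Sum>I\<in>F. (\<Prod>h\<in>I. a h) - (\<Prod>h\<in>I. b h))"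
    using tangent by (rule sum_mono)
  finally show ?thesis
    by (simp add: esym_def F_def sum_subtractf)
qed

section \<open>The extremal sequence\<close>

text \<open>With empty sums read as 0, the recursion also yields the initial values 1 and 2, so
  later inductions need no special start.\<close>

lemma vseq_Suc:
  "vseq (Suc m) = 1 + esym m (Suc 0) (\<lambda>i. 1 / vseq i) / (1 - esym m 2 (\<lambda>i. 1 / vseq i))"
proof -
  consider "m = 0" | "m = 1" | "m \<ge> 2" by linarith
  then show ?thesis
  proof cases
    case 3
    then show ?thesis
      using vseq_rec[OF 3] by (simp add: esym_1 esym_2 del: vseq.simps)
  qed (simp_all add: esym_1 esym_2)
qed

declare vseq.simps [simp del]

text \<open>Proved jointly: once \<open>1 - e\<^sub>2 = 1/P\<close>, the recursion reads
  \<open>v = 1 + e\<^sub>1 * P\<close>, which gives positivity of the next term \<open>v\<close> and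
  shrinks the gap from \<open>1/P\<close> to \<open>1/(P * v)\<close>.\<close>

lemma vseq_pos_and_esym_2:
  "(\<forall>i\<in>{1..m}. 0 < vseq i) \<and> esym m 2 (\<lambda>i. 1 / vseq i) = 1 - 1 / (\<Prod>i = 1..m. vseq i)"
proof (induction m)
  case 0
  show ?case by (simp add: numeral_2_eq_2)
next
  case (Suc m)
  let ?w = "\<lambda>i. 1 / vseq i" and ?P = "\<Prod>i = 1..m. vseq i"
  have P: "?P > 0" using Suc by (intro prod_pos) auto
  have s: "esym m (Suc 0) ?w \<ge> 0"
    using Suc by (intro esym_nonneg) (auto intro: less_imp_le)
  have v: "vseq (Suc m) = 1 + esym m (Suc 0) ?w * ?P"
    using Suc vseq_Suc[of m] by simp
  have pos: "vseq (Suc m) > 0"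
    using v s P by (simp add: add_pos_nonneg)
  have alg: "1 - 1 / p + (v - 1) / p / v = 1 - 1 / (p * v)" if "0 < p" "0 < v" for p v :: real
    using that by (simp add: field_simps)
  have "esym (Suc m) 2 ?w = 1 - 1 / ?P + esym m (Suc 0) ?w / vseq (Suc m)"
    using Suc by (simp add: numeral_2_eq_2 esym_Suc_Suc)
  also have "esym m (Suc 0) ?w = (vseq (Suc m) - 1) / ?P"
    using less_imp_neq[OF P] v by (metis add_diff_cancel_left' nonzero_mult_div_cancel_right)
  also have "1 - 1 / ?P + (vseq (Suc m) - 1) / ?P / vseq (Suc m) = 1 - 1 / (?P * vseq (Suc m))"
    using P pos by (rule alg)
  finally show ?case
    using Suc pos by (auto simp: atLeastAtMostSuc_conv mult.commute)
qed

lemma vseq_pos: "1 \<le> i \<Longrightarrow> 0 < vseq i"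
  using vseq_pos_and_esym_2[of i] by auto

lemma vseq_prod_pos: "0 < (\<Prod>i = 1..m. vseq i)"
  using vseq_pos by (intro prod_pos) auto

lemma vseq_Suc_prod:
  "vseq (Suc m) - 1 = (\<Prod>i = 1..m. vseq i) * esym m (Suc 0) (\<lambda>i. 1 / vseq i)"
  using vseq_Suc[of m] vseq_pos_and_esym_2[of m] by simp

text \<open>The exact difference of the two sides is the product of the first \<open>m\<close>
  terms, which is positive.\<close>

lemma vseq_Suc_Suc_ge: "vseq (Suc m) * (vseq (Suc m) - 1) \<le> vseq (Suc (Suc m)) - 1"
proof -
  let ?v = "vseq (Suc m)" and ?w = "\<lambda>i. 1 / vseq i" and ?P = "\<Prod>i = 1..m. vseq i"
  have "vseq (Suc (Suc m)) - 1 = ?P * ?v * (esym m (Suc 0) ?w + 1 / ?v)"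
    using vseq_Suc_prod[of "Suc m"] by (simp add: esym_Suc_Suc mult.commute)
  also have "\<dots> = ?v * (?P * esym m (Suc 0) ?w) + ?P"
    using vseq_pos[of "Suc m"] by (simp add: field_simps)
  also have "\<dots> = ?v * (?v - 1) + ?P"
    by (simp add: vseq_Suc_prod)
  finally show ?thesis
    using vseq_prod_pos[of m] by linarith
qed

text \<open>Telescoping of \<open>1 / v + 1 / (v' - 1) \<le> 1 / (v - 1)\<close> for consecutive terms \<open>v\<close>, \<open>v'\<close>.\<close>
lemma vseq_tail_bound:
  assumes "0 \<le> r" and "r * (vseq (Suc (k + l)) - 1) \<le> 1"
  shows "(r + esym l (Suc 0) (\<lambda>i. 1 / vseq (k + i))) * (vseq (Suc k) - 1) \<le> 1"
  using assms
proof (induction l arbitrary: r)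
  case (Suc l)
  let ?v = "vseq (Suc (k + l))"
  have v: "?v > 0" by (simp add: vseq_pos)
  have "r * (?v * (?v - 1)) \<le> r * (vseq (Suc (Suc (k + l))) - 1)"
    using Suc.prems vseq_Suc_Suc_ge by (intro mult_left_mono) auto
  also have "\<dots> \<le> 1" using Suc.prems by simp
  finally have "(r + 1 / ?v) * (?v - 1) \<le> 1"
    using v by (simp add: field_simps)
  \<comment> \<open>The last term of the tail is absorbed into \<open>r\<close>, which is why
    \<open>r\<close> is arbitrary in the induction.\<close>
  from Suc.IH[OF _ this] show ?case
    using Suc.prems v by (simp add: esym_Suc_Suc algebra_simps)
qed simp

section \<open>Integrality and the extremal inequality\<close>

text \<open>The product times \<open>e\<^sub>2\<close> of the reciprocals is a natural number below
  the product, hence smaller by at least 1.\<close>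

lemma one_minus_esym_2_ge:
  fixes x :: "nat \<Rightarrow> nat"
  assumes pos: "\<And>i. i \<in> {1..m} \<Longrightarrow> 0 < x i" and less: "esym m 2 (\<lambda>i. 1 / real (x i)) < 1"
  shows "1 / (\<Prod>i = 1..m. real (x i)) \<le> 1 - esym m 2 (\<lambda>i. 1 / real (x i))"
proof -
  let ?P = "\<Prod>i = 1..m. x i" and ?T = "esym m 2 (\<lambda>i. 1 / real (x i))"
  have P: "?P > 0" using pos by (intro prod_pos) auto
  obtain t :: nat where t: "real ?P * ?T = real t"
  proof (cases "2 \<le> m")
    case True
    then have "real ?P * ?T = esym m (m - 2) (\<lambda>i. real (x i))"
      using pos by (subst esym_reciprocal) auto
    with that show ?thesis by (simp add: esym_of_nat)
  next
    \<comment> \<open>Here \<open>m - 2\<close> would be truncated, but \<open>e\<^sub>2\<close> of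
      fewer than two variables is 0.\<close>
    case False
    with that[of 0] show ?thesis by (simp add: esym_eq_0)
  qed
  have "real t < real ?P"
    using less P t mult_strict_left_mono[of ?T 1 "real ?P"] by (simp only: of_nat_0_less_iff mult_1_right)
  then have "1 \<le> real ?P - real t" unfolding of_nat_less_iff by linarith
  then have "1 \<le> real ?P * (1 - ?T)" using t by (simp add: right_diff_distrib)
  moreover have "0 < real ?P" using P by (simp only: of_nat_0_less_iff)
  ultimately show ?thesis by (metis mult.commute of_nat_prod pos_divide_le_eq)
qed

lemma prod_div_prefix:
  fixes x :: "nat \<Rightarrow> real"
  shows "(\<Prod>i = 1..k. c / x i) = c ^ k / (\<Prod>i = 1..k. x i)"
  by (simp add: prod_dividef)

lemma esym_vseq_extremal:
  fixes x :: "nat \<Rightarrow> nat"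
  assumes "\<And>i. i \<in> {1..m} \<Longrightarrow> 0 < x i"
    and "\<And>i. 1 \<le> i \<Longrightarrow> i < m \<Longrightarrow> x i \<le> x (Suc i)"
    and "esym m 2 (\<lambda>i. 1 / real (x i)) < 1"
    and "0 \<le> r" and "r * (vseq (Suc m) - 1) \<le> 1"
  shows "esym m 2 (\<lambda>i. 1 / real (x i)) + r * esym m (Suc 0) (\<lambda>i. 1 / real (x i))
    \<le> esym m 2 (\<lambda>i. 1 / vseq i) + r * esym m (Suc 0) (\<lambda>i. 1 / vseq i)"
  using assms
proof (induction m arbitrary: r rule: less_induct)
  case (less m)
  define y where "y i = 1 / real (x i)" for i
  define w where "w i = 1 / vseq i" for i
  define p where "p k = (\<Prod>i = 1..k. real (x i))" for k
  define q where "q k = (\<Prod>i = 1..k. vseq i)" for k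
  have p: "0 < p k" if "k \<le> m" for k
    using less.prems(1) that unfolding p_def by (intro prod_pos) auto
  have q: "0 < q k" for k
    by (simp only: q_def vseq_prod_pos)
  have y: "0 < y i" if "i \<in> {1..m}" for i
    using less.prems(1)[OF that] by (simp add: y_def)
  have w: "0 < w i" if "1 \<le> i" for i
    using vseq_pos[OF that] by (simp add: w_def)
  \<comment> \<open>The index 0 competes too, with ratio 1 from the empty products; so
    \<open>k = 0\<close> is possible, and the minimal ratio is at most 1.\<close>
  obtain k where k: "k \<le> m" "\<And>j. j \<le> m \<Longrightarrow> p k / q k \<le> p j / q j"
  proof -
    have "Min ((\<lambda>j. p j / q j) ` {..m}) \<in> (\<lambda>j. p j / q j) ` {..m}"
      by (intro Min_in) auto
    then obtain k where "k \<le> m" "p k / q k = Min ((\<lambda>j. p j / q j) ` {..m})"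
      by (metis (no_types, lifting) atMost_iff imageE)
    with that[of k] show ?thesis by simp
  qed
  have "esym m 2 y + r * esym m (Suc 0) y \<le> esym m 2 w + r * esym m (Suc 0) w"
  proof (cases "k = m")
    case True
    have pq: "p m * q j \<le> q m * p j" if "j \<le> m" for j
      using k(2)[OF that] True q[of j] q[of m] by (simp add: field_simps)
    have le: "p m \<le> q m"
      using pq[of 0] by (simp add: p_def q_def)
    have "esym m (Suc 0) (\<lambda>i. p m / x i) \<le> esym m (Suc 0) (\<lambda>i. q m / vseq i)"
    proof (rule esym_mono_log_majorization)
      fix j assume j: "j \<le> m"
      show "(\<Prod>i = 1..j. p m / x i) \<le> (\<Prod>i = 1..j. q m / vseq i)"
      proof (cases j)
        case (Suc h)
        \<comment> \<open>Of the \<open>j = Suc h\<close> factors \<open>p m\<close>, one is paired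
          with \<open>p j\<close> through minimality of the ratio; the other \<open>h\<close> are
          compared by \<open>p m <= q m\<close>.\<close>
        have "p m * q j * p m ^ h \<le> q m * p j * q m ^ h"
          using less_imp_le[OF p[of m]] less_imp_le[OF p[OF j]] less_imp_le[OF q[of m]]
          by (intro mult_mono[OF pq[OF j] power_mono[OF le]]) auto
        then have "p m ^ j / p j \<le> q m ^ j / q j"
          using p[OF j] q[of j] Suc by (simp add: field_simps)
        then show ?thesis
          by (simp only: prod_div_prefix p_def[symmetric] q_def[symmetric])
      qed simp
    qed (use p[of m] q[of m] less.prems(1,2) vseq_pos in \<open>auto intro!: divide_left_mono\<close>)
    then have S: "p m * esym m (Suc 0) y \<le> q m * esym m (Suc 0) w"
      by (simp add: esym_1 y_def w_def sum_distrib_left)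
    have N: "q m * esym m (Suc 0) w = vseq (Suc m) - 1"
      by (simp add: vseq_Suc_prod q_def w_def[abs_def])
    have T: "esym m 2 y \<le> 1 - 1 / p m"
      using one_minus_esym_2_ge[OF less.prems(1,3)] by (simp add: y_def[abs_def] p_def)
    have Tw: "esym m 2 w = 1 - 1 / q m"
      using vseq_pos_and_esym_2[of m] by (simp add: w_def[abs_def] q_def)
    let ?N = "vseq (Suc m) - 1"
    have "esym m (Suc 0) y \<le> ?N / p m"
      using S N p[of m] by (simp add: field_simps)
    then have "esym m 2 y + r * esym m (Suc 0) y \<le> 1 - 1 / p m + r * (?N / p m)"
      using T less.prems(4) by (intro add_mono mult_left_mono)
    also have "\<dots> = 1 - (1 - r * ?N) * (1 / p m)"
      by (simp add: algebra_simps diff_divide_distrib add_divide_distrib)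
    \<comment> \<open>The bound on \<open>r\<close> makes \<open>1 - r * ?N\<close> nonnegative, so
      enlarging \<open>p m\<close> to \<open>q m\<close> raises the value.\<close>
    also have "\<dots> \<le> 1 - (1 - r * ?N) * (1 / q m)"
      using less.prems(5) le p[of m] q[of m]
      by (intro diff_left_mono mult_left_mono divide_left_mono) auto
    also have "\<dots> = esym m 2 w + r * (?N / q m)"
      using Tw by (simp add: algebra_simps diff_divide_distrib add_divide_distrib)
    also have "?N / q m = esym m (Suc 0) w"
      using N q[of m] by (simp add: field_simps)
    finally show ?thesis .
  next
    case False
    define l where "l = m - k"
    have m: "m = k + l" "k < m" using k(1) False by (auto simp: l_def)
    have tail: "esym l j (\<lambda>i. y (k + i)) \<le> esym l j (\<lambda>i. w (k + i))" for j
    proof (rule esym_mono_log_majorization)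
      fix h assume h: "h \<le> l"
      have ph: "p (k + h) = p k * (\<Prod>i = 1..h. real (x (k + i)))"
        and qh: "q (k + h) = q k * (\<Prod>i = 1..h. vseq (k + i))"
        by (simp_all only: p_def q_def prod_1_add)
      have pos: "0 < (\<Prod>i = 1..h. real (x (k + i)))" "0 < (\<Prod>i = 1..h. vseq (k + i))"
        using less.prems(1) vseq_pos h m by (auto intro!: prod_pos)
      \<comment> \<open>Dividing the minimal ratio out of the ratio at \<open>k + h\<close> leaves
        the prefix comparison for the tail.\<close>
      have "p k / q k \<le> p (k + h) / q (k + h)"
        using k(2) h m by simp
      then have "(\<Prod>i = 1..h. vseq (k + i)) \<le> (\<Prod>i = 1..h. real (x (k + i)))"
        unfolding ph qh using p[OF k(1)] q[of k] pos by (simp add: field_simps)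
      then show "(\<Prod>i = 1..h. y (k + i)) \<le> (\<Prod>i = 1..h. w (k + i))"
        unfolding y_def w_def prod_div_prefix using pos by (simp add: field_simps)
    next
      fix i assume "1 \<le> i" "i < l"
      then show "y (k + Suc i) \<le> y (k + i)"
        using less.prems(1)[of "k + i"] less.prems(2)[of "k + i"] m
        by (auto simp: y_def intro!: divide_left_mono)
    qed (use y w m in auto)
    let ?E = "esym l (Suc 0) (\<lambda>i. w (k + i))"
    have E: "0 \<le> ?E"
      using w by (intro esym_nonneg) (auto intro: less_imp_le)
    have y0: "0 \<le> esym k (Suc 0) y"
      using y m by (intro esym_nonneg) (auto intro: less_imp_le)
    have yl: "0 \<le> esym l j (\<lambda>i. y (k + i))" for j
      using y m by (intro esym_nonneg) (auto intro: less_imp_le)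
    have "esym k 2 y \<le> esym m 2 y"
      unfolding m(1) esym_2_add using y0 yl by simp
    then have "esym k 2 y < 1"
      using less.prems(3) by (simp add: y_def[abs_def])
    moreover have "(r + ?E) * (vseq (Suc k) - 1) \<le> 1"
      using vseq_tail_bound[of r k l] less.prems(4,5) m by (simp add: w_def)
    ultimately have IH: "esym k 2 y + (r + ?E) * esym k (Suc 0) y
        \<le> esym k 2 w + (r + ?E) * esym k (Suc 0) w"
      using less.IH[OF m(2), of "r + ?E"] less.prems(1,2,4) m E
      by (simp add: y_def[abs_def] w_def[abs_def])
    \<comment> \<open>Bounding the tail factor of the mixed term by \<open>?E\<close> gives the
      \<open>?E * esym k (Suc 0) y\<close> that the induction hypothesis, taken at
      \<open>r + ?E\<close>, absorbs.\<close>
    have "esym k (Suc 0) y * esym l (Suc 0) (\<lambda>i. y (k + i)) \<le> esym k (Suc 0) y * ?E"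
      using tail y0 by (intro mult_left_mono)
    moreover have "r * esym l (Suc 0) (\<lambda>i. y (k + i)) \<le> r * ?E"
      using tail less.prems(4) by (intro mult_left_mono)
    ultimately show ?thesis
      using IH tail[of 2] unfolding m(1) esym_2_add esym_1_add
      by (simp add: algebra_simps)
  qed
  then show ?case by (simp add: y_def[abs_def] w_def[abs_def])
qed

section \<open>The bound on the largest variable\<close>

theorem theorem10:
  fixes n :: nat and x :: "nat \<Rightarrow> nat"
  assumes "n \<ge> 3"
    and "\<And>i. i \<in> {1..n} \<Longrightarrow> 0 < x i"
    and "\<And>i j. 1 \<le> i \<Longrightarrow> i \<le> j \<Longrightarrow> j \<le> n \<Longrightarrow> x i \<le> x j"
    and "esym n (n - 2) x = esym n n x"
  shows "real (x n) \<le> vseq n - 1"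
proof -
  define y where "y i = 1 / real (x i)" for i
  define m where "m = n - 1"
  have n: "n = Suc m" and m: "2 \<le> m" using assms(1) by (auto simp: m_def)
  let ?P = "\<Prod>i = 1..n. real (x i)" and ?S = "esym m (Suc 0) y" and ?v = "vseq (Suc m) - 1"
  have P: "?P > 0" using assms(2) by (intro prod_pos) auto
  have "?P * esym n 2 y = esym n (n - 2) (\<lambda>i. real (x i))"
    using assms(1,2) esym_reciprocal[of 2 n "\<lambda>i. real (x i)"] by (simp add: y_def[abs_def])
  also have "\<dots> = esym n n (\<lambda>i. real (x i))"
    using assms(4) by (simp add: esym_of_nat)
  also have "\<dots> = ?P" by (rule esym_self)
  finally have "esym n 2 y = 1" using P by (metis less_irrefl mult_cancel_left1)
  \<comment> \<open>Splitting off the last variable: \<open>1 / x n\<close> stands where the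
    extremal inequality has \<open>r\<close>.\<close>
  then have T: "esym m 2 y + ?S / x n = 1"
    by (simp add: n numeral_2_eq_2 esym_Suc_Suc y_def)
  have S: "?S > 0"
    unfolding esym_1 using assms(2) m by (intro sum_pos) (auto simp: y_def n)
  have xn: "x n > 0" using assms(1,2) by simp
  have v: "?v > 0"
    unfolding vseq_Suc_prod esym_1 using m vseq_pos vseq_prod_pos[of m]
    by (intro mult_pos_pos sum_pos) auto
  \<comment> \<open>For \<open>r = 1 / ?v\<close>, the largest admissible value, the term with
    \<open>r\<close> exactly fills the gap \<open>1 - e\<^sub>2\<close> of the sequence.\<close>
  have w: "esym m 2 (\<lambda>i. 1 / vseq i) + 1 / ?v * esym m (Suc 0) (\<lambda>i. 1 / vseq i) = 1"
  proof -
    have "esym m (Suc 0) (\<lambda>i. 1 / vseq i) = ?v / (\<Prod>i = 1..m. vseq i)"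
      unfolding vseq_Suc_prod using vseq_prod_pos[of m]
      by (metis less_irrefl nonzero_mult_div_cancel_left)
    then show ?thesis using vseq_pos_and_esym_2[of m] v by simp
  qed
  have "esym m 2 y < 1" using T S xn by (smt (verit) divide_pos_pos of_nat_0_less_iff)
  then have "esym m 2 y + 1 / ?v * ?S \<le> 1"
    using esym_vseq_extremal[of m x "1 / ?v"] assms(2,3) v w n by (simp add: y_def[abs_def])
  with T have "?S / ?v \<le> ?S / x n" by simp
  moreover have "?S / x n < ?S / ?v" if "?v < x n"
    using that S xn v by (intro divide_strict_left_mono) auto
  ultimately show ?thesis using n by fastforce
qed

end
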